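(* Let $(P_j)_{j\ge 1}$ be a simulated annealing process on $(\Theta,\mathcal{T},\upsilon)$ for the function $h$ with temperatures $(T_j)_{j\ge1}$ (see context). Suppose that there exist sequences of integers $(n_j)_{j\ge 1}$ and $(r_j)_{j\ge 1}$ and a number $0<d<1$ such that $(n_j)$ is (strictly) increasing, $\lim_{j\to\infty}(j-r_j)=\infty$ and $\lim_{j\to\infty}r_j=\infty$. Assume also that: (i) for each $j\ge 1$, $$c\big(P^{(n_j,n_{j+1})}\big)\le 1-(1-d)\exp\Big[-\sum_{l=n_j+1}^{n_{j+1}}\frac{\Delta h}{T_l}\Big];$$ (ii) $$\lim_{k\to\infty}\sum_{j=r_k}^{k}\exp\Big(-\sum_{l=n_j+1}^{n_{j+1}}\frac{\Delta h}{T_l}\Big)=\infty;$$ (iii) $$\lim_{k\to\infty}\frac{\mathcal{L}_h(1/T_{n_{r_k}})}{\mathcal{L}_h(1/T_{n_{k+2}})}=1,\qquad\text{where }\mathcal{L}_h(1/T)=\int_\Theta\exp(-h(\theta)/T)\,\upsilon(d\theta).$$ Then, for any initial distribution $\mu_0$ on $(\Theta,\mathcal{T})$, the successive distributions $\mu_j=\mu_{j-1}P_j$ satisfy $$\lim_{j\to\infty}\|\mu_j-\pi_j\|=0 .$$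
   Context: **Setting.** $\Theta\subset\mathbb{R}^r$ is a compact region with Borel $\sigma$-algebra $\mathcal{T}$, and $\upsilon$ is a probability measure on $(\Theta,\mathcal{T})$. The function $h:\Theta\to\mathbb{R}$ is measurable, nonnegative and bounded, with global minimum value $0$; $\Delta h=\sup_{\theta\in\Theta}h(\theta)$. The norm is total variation, $\|\mu-\lambda\|=\sup_{A\in\mathcal{T}}|\mu(A)-\lambda(A)|$. **Simulated annealing process.** Let $T_1\ge T_2\ge\dots>0$ with $T_j\to 0$. For each $j$ let $q=q_j(\theta\to\psi)\ge 0$ be a measurable proposal density with respect to $\upsilon$, i.e. $\int_\Theta q(\theta\to\psi)\upsilon(d\psi)=1$ for all $\theta$. A simulated annealing process is the non-homogeneous Markov process given by the sequence of transition kernels $$P_j(\theta,A)=\int_A\alpha_j(\theta\to\psi)q(\theta\to\psi)\,\upsilon(d\psi)+\mathbf{1}\{\theta\in A\}\Big[1-\int_\Theta\alpha_j(\theta\to\psi)q(\theta\to\psi)\,\upsilon(d\psi)\Big],$$ $$\alpha_j(\theta\to\psi)=\min\Big\{1,\Big[\frac{\exp(-h(\psi))}{\exp(-h(\theta))}\Big]^{1/T_j}\frac{q(\psi\to\theta)}{q(\theta\to\psi)}\Big\}$$ (with $\alpha_j(\theta\to\psi)=1$ where $q(\theta\to\psi)=0$). The equilibrium distributions are $$\pi_j(A)=\int_A\frac{\exp(-h(\theta)/T_j)}{c_j}\,\upsilon(d\theta),\qquad c_j=\int_\Theta\exp(-h(\theta)/T_j)\,\upsilon(d\theta).$$ **Notation.**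 For a measure $\mu$ and kernel $P$, $\mu P(A)=\int\mu(d\theta)P(\theta,A)$. For $m+1\le k$, $P^{(m,k)}=P_{m+1}P_{m+2}\cdots P_k$. The Dobrushin coefficient of a kernel $P$ is $c(P)=\sup_{\theta,\psi\in\Theta}\sup_{A\in\mathcal{T}}|P(\theta,A)-P(\psi,A)|$. *)

theory Defs
  imports "HOL-Probability.Probability"
begin

definition tv_dist :: "'a measure \<Rightarrow> 'a measure \<Rightarrow> real" where
  "tv_dist \<mu> \<nu> = (SUP A\<in>sets \<mu>. \<bar>measure \<mu> A - measure \<nu> A\<bar>)"

definition dobrushin :: "'a measure \<Rightarrow> ('a \<Rightarrow> 'a measure) \<Rightarrow> real" where
  "dobrushin M K =
     (SUP (\<theta>, \<psi>, A)\<in>space M \<times> space M \<times> sets M. \<bar>measure (K \<theta>) A - measure (K \<psi>) A\<bar>)"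

(* P^(m,k) = P_(m+1) ... P_k, the kernels being applied from left to right;
   for k <= m this is the empty product, the identity kernel. *)
primrec kernel_prod ::
    "'a measure \<Rightarrow> (nat \<Rightarrow> 'a \<Rightarrow> 'a measure) \<Rightarrow> nat \<Rightarrow> nat \<Rightarrow> 'a \<Rightarrow> 'a measure" where
  "kernel_prod M P m 0 = return M"
| "kernel_prod M P m (Suc k) =
     (if m < Suc k then (\<lambda>\<theta>. kernel_prod M P m k \<theta> \<bind> P (Suc k)) else return M)"

definition acceptance :: "('a \<Rightarrow> real) \<Rightarrow> real \<Rightarrow> ('a \<Rightarrow> 'a \<Rightarrow> real) \<Rightarrow> 'a \<Rightarrow> 'a \<Rightarrow> real" where
  "acceptance h t q \<theta> \<psi> =
     (if q \<theta> \<psi> = 0 then 1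
      else min 1 ((exp (- h \<psi>) / exp (- h \<theta>)) powr (1 / t) * (q \<psi> \<theta> / q \<theta> \<psi>)))"

definition annealing_prob ::
    "'a measure \<Rightarrow> ('a \<Rightarrow> real) \<Rightarrow> real \<Rightarrow> ('a \<Rightarrow> 'a \<Rightarrow> real) \<Rightarrow> 'a \<Rightarrow> 'a set \<Rightarrow> real" where
  "annealing_prob \<upsilon> h t q \<theta> A =
     (LINT \<psi>:A|\<upsilon>. acceptance h t q \<theta> \<psi> * q \<theta> \<psi>) +
     indicator A \<theta> * (1 - (LINT \<psi>|\<upsilon>. acceptance h t q \<theta> \<psi> * q \<theta> \<psi>))"

(* measure_of collapses to the null measure when its argument is not countably additive;
   emeasure_annealing_kernel below shows that this does not happen here. *)
definition annealing_kernel ::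
    "'a measure \<Rightarrow> ('a \<Rightarrow> real) \<Rightarrow> (nat \<Rightarrow> real) \<Rightarrow> (nat \<Rightarrow> 'a \<Rightarrow> 'a \<Rightarrow> real) \<Rightarrow> nat \<Rightarrow> 'a \<Rightarrow> 'a measure"
  where
  "annealing_kernel \<upsilon> h T q j \<theta> =
     measure_of (space \<upsilon>) (sets \<upsilon>) (\<lambda>A. ennreal (annealing_prob \<upsilon> h (T j) (q j) \<theta> A))"

definition laplace :: "'a measure \<Rightarrow> ('a \<Rightarrow> real) \<Rightarrow> real \<Rightarrow> real" where
  "laplace \<upsilon> h s = (LINT \<theta>|\<upsilon>. exp (- (h \<theta> * s)))"

definition equilibrium :: "'a measure \<Rightarrow> ('a \<Rightarrow> real) \<Rightarrow> (nat \<Rightarrow> real) \<Rightarrow> nat \<Rightarrow> 'a measure" where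
  "equilibrium \<upsilon> h T j =
     density \<upsilon> (\<lambda>\<theta>. ennreal (exp (- h \<theta> / T j) / (LINT \<theta>|\<upsilon>. exp (- h \<theta> / T j))))"

(* The sequences T and q are indexed by j >= 1; their values at 0 are irrelevant. *)
locale simulated_annealing =
  fixes \<Theta> :: "(real ^ 'r) set"
    and \<upsilon> :: "(real ^ 'r) measure"
    and h :: "real ^ 'r \<Rightarrow> real"
    and T :: "nat \<Rightarrow> real"
    and q :: "nat \<Rightarrow> real ^ 'r \<Rightarrow> real ^ 'r \<Rightarrow> real"
  assumes compact_region: "compact \<Theta>"
    and sets_base: "sets \<upsilon> = sets (restrict_space borel \<Theta>)"
    and prob_base: "prob_space \<upsilon>"
    and h_measurable: "h \<in> borel_measurable \<upsilon>"
    and h_nonneg: "\<And>\<theta>. \<theta> \<in> \<Theta> \<Longrightarrow> 0 \<le> h \<theta>"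
    and h_bounded: "bounded (h ` \<Theta>)"
    and h_min: "\<exists>\<theta>\<in>\<Theta>. h \<theta> = 0"
    and T_pos: "\<And>j. 1 \<le> j \<Longrightarrow> 0 < T j"
    and T_decreasing: "\<And>i j. 1 \<le> i \<Longrightarrow> i \<le> j \<Longrightarrow> T j \<le> T i"
    and T_tendsto: "T \<longlonglongrightarrow> 0"
    and q_measurable: "\<And>j. 1 \<le> j \<Longrightarrow> (\<lambda>(\<theta>, \<psi>). q j \<theta> \<psi>) \<in> borel_measurable (\<upsilon> \<Otimes>\<^sub>M \<upsilon>)"
    and q_nonneg: "\<And>j \<theta> \<psi>. 1 \<le> j \<Longrightarrow> \<theta> \<in> \<Theta> \<Longrightarrow> \<psi> \<in> \<Theta> \<Longrightarrow> 0 \<le> q j \<theta> \<psi>"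
    and q_density: "\<And>j \<theta>. 1 \<le> j \<Longrightarrow> \<theta> \<in> \<Theta> \<Longrightarrow> (LINT \<psi>|\<upsilon>. q j \<theta> \<psi>) = 1"
begin

lemma space_base: "space \<upsilon> = \<Theta>"
  using sets_eq_imp_space_eq[OF sets_base] by (simp add: space_restrict_space)

lemma move_density_measurable:
  assumes "1 \<le> j"
  shows "(\<lambda>(\<theta>, \<psi>). acceptance h (T j) (q j) \<theta> \<psi> * q j \<theta> \<psi>) \<in> borel_measurable (\<upsilon> \<Otimes>\<^sub>M \<upsilon>)"
proof -
  note [measurable] = h_measurable
  have [measurable]: "(\<lambda>x. q j (fst x) (snd x)) \<in> borel_measurable (\<upsilon> \<Otimes>\<^sub>M \<upsilon>)"
    using q_measurable[OF assms] by (simp add: case_prod_unfold)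
  have "(\<lambda>x. (snd x, fst x)) \<in> measurable (\<upsilon> \<Otimes>\<^sub>M \<upsilon>) (\<upsilon> \<Otimes>\<^sub>M \<upsilon>)"
    by measurable
  from measurable_compose[OF this q_measurable[OF assms]]
  have [measurable]: "(\<lambda>x. q j (snd x) (fst x)) \<in> borel_measurable (\<upsilon> \<Otimes>\<^sub>M \<upsilon>)"
    by simp
  show ?thesis
    unfolding acceptance_def case_prod_unfold by measurable
qed

lemma move_density:
  assumes j: "1 \<le> j" and \<theta>: "\<theta> \<in> \<Theta>"
  defines "f \<equiv> \<lambda>\<psi>. acceptance h (T j) (q j) \<theta> \<psi> * q j \<theta> \<psi>"
  shows move_density_nonneg: "\<psi> \<in> \<Theta> \<Longrightarrow> 0 \<le> f \<psi>"
    and move_density_integrable: "integrable \<upsilon> f"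
    and move_density_le_1: "(LINT \<psi>|\<upsilon>. f \<psi>) \<le> 1"
proof -
  have bnds: "0 \<le> f \<psi> \<and> f \<psi> \<le> q j \<theta> \<psi>" if "\<psi> \<in> \<Theta>" for \<psi>
  proof -
    have "0 \<le> q j \<theta> \<psi>" "0 \<le> q j \<psi> \<theta>" using q_nonneg j \<theta> that by auto
    moreover from this have "0 \<le> acceptance h (T j) (q j) \<theta> \<psi>" "acceptance h (T j) (q j) \<theta> \<psi> \<le> 1"
      unfolding acceptance_def by auto
    ultimately show ?thesis unfolding f_def by (simp add: mult_left_le_one_le)
  qed
  then show "\<psi> \<in> \<Theta> \<Longrightarrow> 0 \<le> f \<psi>" by blast
  have int_q: "integrable \<upsilon> (q j \<theta>)"
    using q_density[OF j \<theta>] not_integrable_integral_eq by fastforce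
  have [measurable]: "f \<in> borel_measurable \<upsilon>"
    using measurable_Pair2[OF move_density_measurable[OF j], of \<theta>] \<theta>
    by (simp add: f_def space_base)
  show int_f: "integrable \<upsilon> f"
    by (rule Bochner_Integration.integrable_bound[OF int_q])
       (use bnds in \<open>force intro!: AE_I2 simp: space_base\<close>)+
  have "(LINT \<psi>|\<upsilon>. f \<psi>) \<le> (LINT \<psi>|\<upsilon>. q j \<theta> \<psi>)"
    by (rule integral_mono[OF int_f int_q]) (use bnds space_base in auto)
  then show "(LINT \<psi>|\<upsilon>. f \<psi>) \<le> 1" using q_density[OF j \<theta>] by simp
qed

lemma space_annealing_kernel [simp]: "space (annealing_kernel \<upsilon> h T q j \<theta>) = \<Theta>"
  unfolding annealing_kernel_def by (simp add: space_measure_of_conv space_base)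

lemma sets_annealing_kernel [simp]: "sets (annealing_kernel \<upsilon> h T q j \<theta>) = sets \<upsilon>"
  unfolding annealing_kernel_def by simp

lemma annealing_prob_eq_emeasure:
  assumes j: "1 \<le> j" and \<theta>: "\<theta> \<in> \<Theta>" and A: "A \<in> sets \<upsilon>"
  defines "f \<equiv> \<lambda>\<psi>. acceptance h (T j) (q j) \<theta> \<psi> * q j \<theta> \<psi>"
  shows "ennreal (annealing_prob \<upsilon> h (T j) (q j) \<theta> A) =
    emeasure (density \<upsilon> f) A + ennreal (1 - (LINT \<psi>|\<upsilon>. f \<psi>)) * emeasure (return \<upsilon> \<theta>) A"
proof -
  have md: "\<And>\<psi>. \<psi> \<in> \<Theta> \<Longrightarrow> 0 \<le> f \<psi>" "integrable \<upsilon> f" "(LINT \<psi>|\<upsilon>. f \<psi>) \<le> 1"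
    unfolding f_def using move_density[OF j \<theta>] by simp_all
  have intA: "integrable \<upsilon> (\<lambda>\<psi>. indicator A \<psi> * f \<psi>)"
    by (rule Bochner_Integration.integrable_bound[OF md(2)])
       (use A md(2) in \<open>auto simp: indicator_def\<close>)
  have "emeasure (density \<upsilon> f) A = (\<integral>\<^sup>+ \<psi>. ennreal (f \<psi>) * indicator A \<psi> \<partial>\<upsilon>)"
    using A md(2) by (subst emeasure_density) auto
  also have "\<dots> = (\<integral>\<^sup>+ \<psi>. ennreal (indicator A \<psi> * f \<psi>) \<partial>\<upsilon>)"
    by (intro nn_integral_cong) (auto simp: indicator_def)
  also have "\<dots> = ennreal (LINT \<psi>|\<upsilon>. indicator A \<psi> * f \<psi>)"
    by (rule nn_integral_eq_integral[OF intA])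
       (auto intro!: AE_I2 md(1) simp: space_base indicator_def)
  finally have 1: "emeasure (density \<upsilon> f) A = ennreal (LINT \<psi>:A|\<upsilon>. f \<psi>)"
    by (simp add: set_lebesgue_integral_def)
  have "0 \<le> (LINT \<psi>|\<upsilon>. indicator A \<psi> * f \<psi>)"
    by (rule Bochner_Integration.integral_nonneg_AE)
       (auto intro!: AE_I2 md(1) simp: space_base indicator_def)
  then have 2: "0 \<le> (LINT \<psi>:A|\<upsilon>. f \<psi>)"
    by (simp add: set_lebesgue_integral_def)
  show ?thesis
    unfolding annealing_prob_def f_def[symmetric] 1
    using md(3) 2 A by (auto simp: indicator_def ennreal_plus)
qed

lemma emeasure_annealing_kernel:
  assumes j: "1 \<le> j" and \<theta>: "\<theta> \<in> \<Theta>" and A: "A \<in> sets \<upsilon>"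
  shows "emeasure (annealing_kernel \<upsilon> h T q j \<theta>) A =
    ennreal (annealing_prob \<upsilon> h (T j) (q j) \<theta> A)"
proof (rule emeasure_measure_of[OF annealing_kernel_def])
  let ?p = "\<lambda>A. ennreal (annealing_prob \<upsilon> h (T j) (q j) \<theta> A)"
  show "sets \<upsilon> \<subseteq> Pow (space \<upsilon>)" by (rule sets.space_closed)
  show "A \<in> sets (annealing_kernel \<upsilon> h T q j \<theta>)" using A by simp
  show "positive (sets (annealing_kernel \<upsilon> h T q j \<theta>)) ?p"
    by (simp add: positive_def annealing_prob_def set_lebesgue_integral_def)
  show "countably_additive (sets (annealing_kernel \<upsilon> h T q j \<theta>)) ?p"
  proof (rule countably_additiveI)
    fix B :: "nat \<Rightarrow> _"
    assume "range B \<subseteq> sets (annealing_kernel \<upsilon> h T q j \<theta>)" and disj: "disjoint_family B"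
      and U: "(\<Union>i. B i) \<in> sets (annealing_kernel \<upsilon> h T q j \<theta>)"
    then have B: "range B \<subseteq> sets \<upsilon>" "\<And>i. B i \<in> sets \<upsilon>" by auto
    show "(\<Sum>i. ?p (B i)) = ?p (\<Union>i. B i)"
      using U B disj
      by (simp add: annealing_prob_eq_emeasure[OF j \<theta>] suminf_add[symmetric]
            suminf_emeasure del: emeasure_return)
  qed
qed

lemma annealing_kernel_measurable:
  assumes j: "1 \<le> j"
  shows "annealing_kernel \<upsilon> h T q j \<in> measurable \<upsilon> (prob_algebra \<upsilon>)"
proof -
  interpret prob_space \<upsilon> by (rule prob_base)
  have ps: "prob_space (annealing_kernel \<upsilon> h T q j \<theta>)" if \<theta>: "\<theta> \<in> \<Theta>" for \<theta>
  proof
    have "emeasure (annealing_kernel \<upsilon> h T q j \<theta>) \<Theta> =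
        ennreal (annealing_prob \<upsilon> h (T j) (q j) \<theta> \<Theta>)"
      using emeasure_annealing_kernel[OF j \<theta>] sets.top[of \<upsilon>] by (simp add: space_base)
    also have "(LINT \<psi>:\<Theta>|\<upsilon>. acceptance h (T j) (q j) \<theta> \<psi> * q j \<theta> \<psi>) =
        (LINT \<psi>|\<upsilon>. acceptance h (T j) (q j) \<theta> \<psi> * q j \<theta> \<psi>)"
      unfolding set_lebesgue_integral_def
      by (intro Bochner_Integration.integral_cong) (auto simp: space_base)
    then have "annealing_prob \<upsilon> h (T j) (q j) \<theta> \<Theta> = 1"
      using \<theta> by (simp add: annealing_prob_def)
    finally show "emeasure (annealing_kernel \<upsilon> h T q j \<theta>)
        (space (annealing_kernel \<upsilon> h T q j \<theta>)) = 1" by simp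
  qed
  have meas: "(\<lambda>\<theta>. emeasure (annealing_kernel \<upsilon> h T q j \<theta>) A) \<in> borel_measurable \<upsilon>"
    if A [measurable]: "A \<in> sets \<upsilon>" for A
  proof -
    note [measurable] = move_density_measurable[OF j]
    have "(\<lambda>\<theta>. ennreal (annealing_prob \<upsilon> h (T j) (q j) \<theta> A)) \<in> borel_measurable \<upsilon>"
      unfolding annealing_prob_def set_lebesgue_integral_def by measurable
    then show ?thesis
      by (rule measurable_cong[THEN iffD1, rotated])
         (simp add: emeasure_annealing_kernel[OF j _ A] space_base)
  qed
  have "annealing_kernel \<upsilon> h T q j \<in> measurable \<upsilon> (subprob_algebra \<upsilon>)"
    by (rule measurable_subprob_algebra)
       (auto simp: space_base ps meas prob_space_imp_subprob_space)
  then show ?thesis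
    by (auto simp: prob_algebra_def measurable_restrict_space2_iff ps space_base)
qed

end

end

theory Submission
  imports Defs
begin

text \<open>
  The acceptance rule makes the \<open>j\<close>-th kernel reversible with respect to the \<open>j\<close>-th equilibrium, so
  the equilibrium \<open>\<pi>\<^sub>j\<close> is stationary for it. Since \<open>\<pi>\<^sub>j\<^sub>+\<^sub>1 \<le> (c\<^sub>j / c\<^sub>j\<^sub>+\<^sub>1) \<pi>\<^sub>j\<close>, the
  distance of consecutive equilibria is at most \<open>1 - c\<^sub>j\<^sub>+\<^sub>1 / c\<^sub>j \<le> ln c\<^sub>j - ln c\<^sub>j\<^sub>+\<^sub>1\<close>, a bound that
  telescopes. Run the chain from time \<open>n (r k)\<close> to a time in \<open>{n (k + 1)..<n (k + 2)}\<close>: the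
  Dobrushin contraction of the blocks \<open>r k, \<dots>, k\<close> erases the initial error by (i) and (ii),
  and the accumulated drift of the equilibria is at most the logarithm of the ratio in (iii).
\<close>

section \<open>Total variation distance and the Dobrushin coefficient\<close>

lemma (in prob_space) abs_measure_diff_le_1:
  assumes "prob_space N"
  shows "\<bar>measure M A - measure N A\<bar> \<le> 1"
  using prob_le_1[of A] prob_space.prob_le_1[OF assms, of A]
    measure_nonneg[of M A] measure_nonneg[of N A]
  by linarith

lemma tv_dist_upper:
  assumes "prob_space M" "prob_space N" "A \<in> sets M"
  shows "\<bar>measure M A - measure N A\<bar> \<le> tv_dist M N"
  unfolding tv_dist_def
  by (rule cSUP_upper[OF assms(3)])
     (auto intro!: bdd_aboveI[where M = 1] prob_space.abs_measure_diff_le_1 assms)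

lemma tv_dist_nonneg:
  assumes "prob_space M" "prob_space N"
  shows "0 \<le> tv_dist M N"
  using tv_dist_upper[OF assms sets.empty_sets] by simp

lemma tv_dist_le_1:
  assumes "prob_space M" "prob_space N"
  shows "tv_dist M N \<le> 1"
  unfolding tv_dist_def
  by (rule cSUP_least) (auto intro!: prob_space.abs_measure_diff_le_1 assms)

lemma tv_dist_self: "tv_dist M M = 0"
proof -
  have "sets M \<noteq> {}" using sets.empty_sets[of M] by blast
  then show ?thesis by (simp add: tv_dist_def)
qed

text \<open>Passing to the complement of \<open>A\<close> reverses the sign of the difference of two
  probability measures, so an upper bound without absolute value suffices.\<close>

lemma tv_dist_leI:
  assumes M: "prob_space M" and N: "prob_space N" and S: "sets M = sets N"
    and le: "\<And>A. A \<in> sets M \<Longrightarrow> measure M A - measure N A \<le> e"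
  shows "tv_dist M N \<le> e"
  unfolding tv_dist_def
proof (rule cSUP_least)
  fix A assume A: "A \<in> sets M"
  have "measure M (space M - A) - measure N (space M - A) \<le> e"
    using A by (intro le) auto
  then have "measure N A - measure M A \<le> e"
    using prob_space.prob_compl[OF M A] prob_space.prob_compl[OF N, of A] A
      sets_eq_imp_space_eq[OF S] S by simp
  with le[OF A] show "\<bar>measure M A - measure N A\<bar> \<le> e" by linarith
qed auto

lemma tv_dist_triangle:
  assumes "prob_space L" "prob_space M" "prob_space N" "sets L = sets M" "sets M = sets N"
  shows "tv_dist L N \<le> tv_dist L M + tv_dist M N"
proof (rule tv_dist_leI)
  fix A assume "A \<in> sets L"
  then show "measure L A - measure N A \<le> tv_dist L M + tv_dist M N"
    using tv_dist_upper[of L M A] tv_dist_upper[of M N A] assms by simp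
qed (use assms in auto)

section \<open>Integrals of one function against two nearby probability measures\<close>

lemma nn_integral_layer_cake:
  assumes "sigma_finite_measure M" and [measurable]: "f \<in> borel_measurable M"
  shows "(\<integral>\<^sup>+x. ennreal (f x) \<partial>M) =
    (\<integral>\<^sup>+t. emeasure M {x \<in> space M. t < f x} * indicator {0..} t \<partial>lborel)"
proof -
  interpret M: sigma_finite_measure M by fact
  interpret pair_sigma_finite lborel M ..
  \<comment> \<open>The region under the graph, 0 <= t < f x. Integrating over x first gives the
    measures of the superlevel sets; integrating over t first gives the length of
    \<open>{0..<f x}\<close>, which is \<open>ennreal (f x)\<close> also for negative values because
    \<open>ennreal\<close> truncates at 0.\<close>
  let ?I = "\<lambda>t x. indicator {x \<in> space M. t < f x} x * indicator {0..} (t::real) :: ennreal"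
  have m: "(\<lambda>(t, x). ?I t x) \<in> borel_measurable (lborel \<Otimes>\<^sub>M M)"
    unfolding indicator_def case_prod_unfold by measurable
  have "(\<integral>\<^sup>+t. emeasure M {x \<in> space M. t < f x} * indicator {0..} t \<partial>lborel)
      = (\<integral>\<^sup>+t. \<integral>\<^sup>+x. ?I t x \<partial>M \<partial>lborel)"
    by (intro nn_integral_cong) (subst nn_integral_multc; simp)
  also have "\<dots> = (\<integral>\<^sup>+x. \<integral>\<^sup>+t. ?I t x \<partial>lborel \<partial>M)"
    using Fubini'[OF m] by simp
  also have "\<dots> = (\<integral>\<^sup>+x. ennreal (f x) \<partial>M)"
  proof (intro nn_integral_cong)
    fix x assume "x \<in> space M"
    then have "(\<integral>\<^sup>+t. ?I t x \<partial>lborel) = (\<integral>\<^sup>+t. indicator {0..<f x} t \<partial>lborel)"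
      by (intro nn_integral_cong) (auto simp: indicator_def)
    also have "\<dots> = ennreal (f x)"
      by (cases "0 \<le> f x") (simp_all add: ennreal_neg)
    finally show "(\<integral>\<^sup>+t. ?I t x \<partial>lborel) = ennreal (f x)" .
  qed
  finally show ?thesis by simp
qed

text \<open>In the layer-cake formula each superlevel set at a height in [0, c) costs at most
  \<open>e\<close>, and those at heights from c on are empty; the total cost is
  \<open>c * e\<close>.\<close>

lemma nn_integral_le_of_measure_le:
  assumes M: "prob_space M" and N: "prob_space N" and S: "sets M = sets N"
    and [measurable]: "f \<in> borel_measurable M"
    and f: "\<And>x. x \<in> space M \<Longrightarrow> f x \<le> c"
    and c: "0 \<le> c" and e: "0 \<le> e"
    and le: "\<And>A. A \<in> sets M \<Longrightarrow> measure M A \<le> measure N A + e"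
  shows "(\<integral>\<^sup>+x. ennreal (f x) \<partial>M) \<le> (\<integral>\<^sup>+x. ennreal (f x) \<partial>N) + ennreal (c * e)"
proof -
  interpret M: prob_space M by fact
  interpret N: prob_space N by fact
  note sp = sets_eq_imp_space_eq[OF S]
  have fN[measurable]: "f \<in> borel_measurable N"
    using assms(4) measurable_cong_sets[OF S refl] by blast
  \<comment> \<open>The superlevel sets are the sections of the measurable set of pairs (t, x) with
    t < f x.\<close>
  have [measurable]: "(\<lambda>t. emeasure N {x \<in> space N. t < f x}) \<in> borel_measurable lborel"
  proof -
    have "(\<lambda>t. emeasure N (Pair t -` {z \<in> space (lborel \<Otimes>\<^sub>M N). fst z < f (snd z)}))
        \<in> borel_measurable lborel"
      by (rule N.measurable_emeasure_Pair) measurable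
    then show ?thesis
      by (simp add: space_pair_measure vimage_def)
  qed
  have "(\<integral>\<^sup>+x. ennreal (f x) \<partial>M) =
      (\<integral>\<^sup>+t. emeasure M {x \<in> space M. t < f x} * indicator {0..} t \<partial>lborel)"
    by (rule nn_integral_layer_cake) (auto intro: M.sigma_finite_measure_axioms)
  also have "\<dots> \<le> (\<integral>\<^sup>+t. emeasure N {x \<in> space N. t < f x} * indicator {0..} t
                        + ennreal e * indicator {0..<c} t \<partial>lborel)"
  proof (rule nn_integral_mono)
    fix t :: real
    show "emeasure M {x \<in> space M. t < f x} * indicator {0..} t
      \<le> emeasure N {x \<in> space N. t < f x} * indicator {0..} t + ennreal e * indicator {0..<c} t"
    proof (cases "0 \<le> t \<and> t < c")
      case True
      have "measure M {x \<in> space M. t < f x} \<le> measure N {x \<in> space M. t < f x} + e"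
        by (rule le) measurable
      then have "ennreal (measure M {x \<in> space M. t < f x})
          \<le> ennreal (measure N {x \<in> space M. t < f x}) + ennreal e"
        using e by (simp flip: ennreal_plus)
      with True show ?thesis
        by (simp add: M.emeasure_eq_measure N.emeasure_eq_measure sp)
    next
      case False
      moreover have "{x \<in> space M. t < f x} = {}" if "c \<le> t"
        using f that by force
      ultimately show ?thesis by (cases "0 \<le> t") (auto simp del: Collect_empty_eq)
    qed
  qed
  also have "\<dots> = (\<integral>\<^sup>+t. emeasure N {x \<in> space N. t < f x} * indicator {0..} t \<partial>lborel)
      + ennreal (c * e)"
    using c e by (subst nn_integral_add) (auto simp: nn_integral_cmult ennreal_mult mult.commute)
  also have "(\<integral>\<^sup>+t. emeasure N {x \<in> space N. t < f x} * indicator {0..} t \<partial>lborel)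
      = (\<integral>\<^sup>+x. ennreal (f x) \<partial>N)"
    by (rule nn_integral_layer_cake[symmetric]) (auto intro: N.sigma_finite_measure_axioms)
  finally show ?thesis .
qed

text \<open>Both measures have mass 1, so subtracting a constant from \<open>f\<close> leaves the
  difference of the integrals unchanged. Subtracting the infimum moves the values into [0, c], where
  the layer-cake comparison applies with the oscillation \<open>c\<close> itself as the
  factor.\<close>

lemma integral_diff_le_oscillation:
  fixes f :: "'a \<Rightarrow> real"
  assumes M: "prob_space M" and N: "prob_space N" and S: "sets M = sets N"
    and f[measurable]: "f \<in> borel_measurable M"
    and b: "\<And>x. x \<in> space M \<Longrightarrow> b \<le> f x"
    and osc: "\<And>x y. x \<in> space M \<Longrightarrow> y \<in> space M \<Longrightarrow> f x - f y \<le> c"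
  shows "(LINT x|M. f x) - (LINT x|N. f x) \<le> c * tv_dist M N"
proof -
  interpret M: prob_space M by fact
  interpret N: prob_space N by fact
  note sp = sets_eq_imp_space_eq[OF S]
  have fN[measurable]: "f \<in> borel_measurable N"
    using f measurable_cong_sets[OF S refl] by blast
  define a where "a = (INF x\<in>space M. f x)"
  have ne: "space M \<noteq> {}" by (rule M.not_empty)
  have a: "a \<le> f x" if "x \<in> space M" for x
    unfolding a_def using that b by (intro cINF_lower bdd_belowI2)
  have ac: "f x - a \<le> c" if x: "x \<in> space M" for x
  proof -
    have "f x - c \<le> a" unfolding a_def
      using osc[OF x] by (intro cINF_greatest ne) (auto simp: algebra_simps)
    then show ?thesis by simp
  qed
  have c: "0 \<le> c" using ne a ac by fastforce
  have bnd: "\<bar>f x\<bar> \<le> \<bar>a\<bar> + \<bar>c\<bar>" if "x \<in> space M" for x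
    using a[OF that] ac[OF that] by linarith
  have iM: "integrable M f"
    by (rule M.integrable_const_bound[where B = "\<bar>a\<bar> + \<bar>c\<bar>"]) (auto intro: bnd)
  have iN: "integrable N f"
    by (rule N.integrable_const_bound[where B = "\<bar>a\<bar> + \<bar>c\<bar>"]) (auto intro!: AE_I2 bnd simp: sp)
  let ?e = "tv_dist M N"
  have e: "0 \<le> ?e" by (rule tv_dist_nonneg[OF M N])
  have "(\<integral>\<^sup>+x. ennreal (f x - a) \<partial>M) \<le> (\<integral>\<^sup>+x. ennreal (f x - a) \<partial>N) + ennreal (c * ?e)"
  proof (rule nn_integral_le_of_measure_le[OF M N S])
    fix A assume "A \<in> sets M"
    from tv_dist_upper[OF M N this] show "measure M A \<le> measure N A + ?e" by linarith
  qed (use ac c e in auto)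
  also have "(\<integral>\<^sup>+x. ennreal (f x - a) \<partial>M) = ennreal (LINT x|M. f x - a)"
    using a iM by (intro nn_integral_eq_integral) auto
  also have "(\<integral>\<^sup>+x. ennreal (f x - a) \<partial>N) = ennreal (LINT x|N. f x - a)"
    using a iN by (intro nn_integral_eq_integral) (auto simp: sp[symmetric])
  finally have "ennreal (LINT x|M. f x - a) \<le> ennreal ((LINT x|N. f x - a) + c * ?e)"
    using a c e by (subst ennreal_plus) (auto intro!: integral_nonneg_AE simp: sp[symmetric])
  moreover have "0 \<le> (LINT x|N. f x - a) + c * ?e"
    using a c e by (intro add_nonneg_nonneg integral_nonneg_AE) (auto simp: sp[symmetric])
  ultimately have "(LINT x|M. f x - a) \<le> (LINT x|N. f x - a) + c * ?e"
    by (simp add: ennreal_le_iff)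
  then show ?thesis
    using iM iN by (simp add: M.prob_space N.prob_space)
qed

section \<open>Action of Markov kernels on the total variation distance\<close>

lemma prob_algebra_kernelD:
  assumes "K \<in> measurable M (prob_algebra N)" "x \<in> space M"
  shows "prob_space (K x)" "sets (K x) = sets N"
  using measurable_space[OF assms] by (auto simp: space_prob_algebra)

lemma measure_bind_prob_algebra:
  assumes \<mu>: "\<mu> \<in> space (prob_algebra M)" and K: "K \<in> measurable M (prob_algebra N)"
    and A: "A \<in> sets N"
  shows "measure (\<mu> \<bind> K) A = (LINT x|\<mu>. measure (K x) A)"
proof -
  interpret prob_space \<mu> using \<mu> by (simp add: space_prob_algebra)
  have "K \<in> measurable \<mu> (subprob_algebra N)"
    using measurable_prob_algebraD[OF K] \<mu> measurable_cong_sets[of \<mu> M]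
    by (auto simp: space_prob_algebra)
  from measure_bind[OF this A] show ?thesis .
qed

lemma dobrushin_upper:
  assumes K: "K \<in> measurable M (prob_algebra M)"
    and "x \<in> space M" "y \<in> space M" "A \<in> sets M"
  shows "\<bar>measure (K x) A - measure (K y) A\<bar> \<le> dobrushin M K"
proof -
  have "(\<lambda>(\<theta>, \<psi>, A). \<bar>measure (K \<theta>) A - measure (K \<psi>) A\<bar>) (x, y, A) \<le> dobrushin M K"
    unfolding dobrushin_def
    by (rule cSUP_upper)
       (use assms in \<open>auto intro!: bdd_aboveI[where M = 1] prob_space.abs_measure_diff_le_1
          prob_algebra_kernelD[OF K]\<close>)
  then show ?thesis by simp
qed

lemma dobrushin_nonneg:
  assumes "K \<in> measurable M (prob_algebra M)" "space M \<noteq> {}"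
  shows "0 \<le> dobrushin M K"
  using dobrushin_upper[OF assms(1) _ _ sets.empty_sets] assms(2) by fastforce

lemma measure_bind_diff_le:
  assumes \<mu>: "\<mu> \<in> space (prob_algebra M)" and \<nu>: "\<nu> \<in> space (prob_algebra M)"
    and K: "K \<in> measurable M (prob_algebra M)"
    and A: "A \<in> sets M"
    and osc: "\<And>x y. x \<in> space M \<Longrightarrow> y \<in> space M \<Longrightarrow> measure (K x) A - measure (K y) A \<le> c"
  shows "measure (\<mu> \<bind> K) A - measure (\<nu> \<bind> K) A \<le> c * tv_dist \<mu> \<nu>"
proof -
  from \<mu> \<nu> have p: "prob_space \<mu>" "prob_space \<nu>" "sets \<mu> = sets M" "sets \<nu> = sets M"
    by (auto simp: space_prob_algebra)
  have "(\<lambda>x. measure (K x) A) \<in> borel_measurable M"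
    using measurable_compose[OF K measurable_measure_prob_algebra[OF A]] by simp
  then have "(\<lambda>x. measure (K x) A) \<in> borel_measurable \<mu>"
    using measurable_cong_sets[OF p(3) refl] by blast
  with p osc show ?thesis
    unfolding measure_bind_prob_algebra[OF \<mu> K A] measure_bind_prob_algebra[OF \<nu> K A]
    by (intro integral_diff_le_oscillation[where b = 0])
       (auto simp: sets_eq_imp_space_eq[OF p(3)])
qed

text \<open>The oscillation bound is applied to the functions mapping x to
  \<open>measure (K x) A\<close>. Taking \<open>c\<close> as the Dobrushin coefficient gives
  contraction; taking \<open>c\<close> as 1 shows that no Markov kernel increases the
  distance.\<close>

lemma tv_dist_bind_le:
  assumes \<mu>: "\<mu> \<in> space (prob_algebra M)" and \<nu>: "\<nu> \<in> space (prob_algebra M)"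
    and K: "K \<in> measurable M (prob_algebra M)"
    and osc: "\<And>x y A. x \<in> space M \<Longrightarrow> y \<in> space M \<Longrightarrow> A \<in> sets M \<Longrightarrow>
      measure (K x) A - measure (K y) A \<le> c"
  shows "tv_dist (\<mu> \<bind> K) (\<nu> \<bind> K) \<le> c * tv_dist \<mu> \<nu>"
  using prob_space_bind'[OF \<mu> K] prob_space_bind'[OF \<nu> K]
    sets_bind'[OF \<mu> K] sets_bind'[OF \<nu> K]
  by (intro tv_dist_leI measure_bind_diff_le[OF \<mu> \<nu> K] osc) auto

lemma tv_dist_bind_le_dobrushin:
  assumes "\<mu> \<in> space (prob_algebra M)" "\<nu> \<in> space (prob_algebra M)"
    and K: "K \<in> measurable M (prob_algebra M)"
  shows "tv_dist (\<mu> \<bind> K) (\<nu> \<bind> K) \<le> dobrushin M K * tv_dist \<mu> \<nu>"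
  using assms by (intro tv_dist_bind_le) (auto dest: dobrushin_upper[OF K])

lemma tv_dist_bind_le_tv_dist:
  assumes "\<mu> \<in> space (prob_algebra M)" "\<nu> \<in> space (prob_algebra M)"
    and K: "K \<in> measurable M (prob_algebra M)"
  shows "tv_dist (\<mu> \<bind> K) (\<nu> \<bind> K) \<le> tv_dist \<mu> \<nu>"
proof -
  have "measure (K x) A - measure (K y) A \<le> 1" if "x \<in> space M" "y \<in> space M" for x y A
    using prob_space.abs_measure_diff_le_1[OF prob_algebra_kernelD(1)[OF K that(1)]
        prob_algebra_kernelD(1)[OF K that(2)], of A] by linarith
  then show ?thesis
    using tv_dist_bind_le[OF assms, of 1] by simp
qed

section \<open>Kernel products with slowly varying stationary distributions\<close>

lemma bind_in_prob_algebra: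
  assumes "\<mu> \<in> space (prob_algebra M)" "K \<in> measurable M (prob_algebra N)"
  shows "\<mu> \<bind> K \<in> space (prob_algebra N)"
  using assms prob_space_bind'[OF assms] sets_bind'[OF assms] by (simp add: space_prob_algebra)

context
  fixes M :: "'a measure" and P :: "nat \<Rightarrow> 'a \<Rightarrow> 'a measure"
  assumes P: "\<And>j. 1 \<le> j \<Longrightarrow> P j \<in> measurable M (prob_algebra M)"
begin

lemma kernel_prod_measurable: "kernel_prod M P m k \<in> measurable M (prob_algebra M)"
  by (induction k) (auto intro!: measurable_bind_prob_space P[of "Suc _"])

lemma bind_kernel_prod_same:
  assumes "sets \<mu> = sets M"
  shows "\<mu> \<bind> kernel_prod M P m m = \<mu>"
  by (cases m) (simp_all add: bind_return'' assms)

lemma bind_kernel_prod_Suc: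
  assumes \<mu>: "\<mu> \<in> space (prob_algebra M)" and "m \<le> k"
  shows "\<mu> \<bind> kernel_prod M P m (Suc k) = (\<mu> \<bind> kernel_prod M P m k) \<bind> P (Suc k)"
proof -
  have "kernel_prod M P m k \<in> measurable \<mu> (subprob_algebra M)"
    using measurable_prob_algebraD[OF kernel_prod_measurable] \<mu> measurable_cong_sets[of \<mu> M]
    by (auto simp: space_prob_algebra)
  moreover have "P (Suc k) \<in> measurable M (subprob_algebra M)"
    by (intro measurable_prob_algebraD P) simp
  ultimately show ?thesis
    using \<open>m \<le> k\<close> by (simp add: bind_assoc)
qed

text \<open>This lets the steps between two times act as one kernel, whose Dobrushin coefficient can
  then be applied to the chain.\<close>

lemma chain_eq_bind_kernel_prod:
  assumes step: "\<And>j. 1 \<le> j \<Longrightarrow> \<mu> j = \<mu> (j - 1) \<bind> P j"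
    and \<mu>: "\<mu> m \<in> space (prob_algebra M)" and "m \<le> k"
  shows "\<mu> k = \<mu> m \<bind> kernel_prod M P m k"
  using \<open>m \<le> k\<close>
proof (induction k rule: dec_induct)
  case base
  then show ?case using \<mu> by (simp add: bind_kernel_prod_same space_prob_algebra)
next
  case (step k)
  then show ?case
    using assms(1)[of "Suc k"] bind_kernel_prod_Suc[OF \<mu> step(1)] by simp
qed

lemma chain_in_prob_algebra:
  assumes step: "\<And>j. 1 \<le> j \<Longrightarrow> \<mu> j = \<mu> (j - 1) \<bind> P j"
    and \<mu>: "\<mu> 0 \<in> space (prob_algebra M)"
  shows "\<mu> k \<in> space (prob_algebra M)"
  using chain_eq_bind_kernel_prod[OF step \<mu>, of k]
    bind_in_prob_algebra[OF \<mu> kernel_prod_measurable] by simp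

text \<open>\<open>D\<close> is a potential whose decrements bound the drift of the stationary
  distributions, so that drifts over consecutive steps telescope. For annealing it is the logarithm
  of the normalising constant.\<close>

context
  fixes \<pi> :: "nat \<Rightarrow> 'a measure" and D :: "nat \<Rightarrow> real"
  assumes \<pi>: "\<And>j. 1 \<le> j \<Longrightarrow> \<pi> j \<in> space (prob_algebra M)"
    and stationary: "\<And>j. 1 \<le> j \<Longrightarrow> \<pi> j \<bind> P j = \<pi> j"
    and drift: "\<And>j. 1 \<le> j \<Longrightarrow> tv_dist (\<pi> j) (\<pi> (Suc j)) \<le> D j - D (Suc j)"
begin

lemma stationary_drift:
  assumes "1 \<le> m" "m \<le> k"
  shows "tv_dist (\<pi> m \<bind> kernel_prod M P m k) (\<pi> k) \<le> D m - D k"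
  using \<open>m \<le> k\<close>
proof (induction k rule: dec_induct)
  case base
  have "sets (\<pi> m) = sets M" using \<pi>[OF \<open>1 \<le> m\<close>] by (simp add: space_prob_algebra)
  then have "\<pi> m \<bind> kernel_prod M P m m = \<pi> m" by (rule bind_kernel_prod_same)
  then show ?case by (simp add: tv_dist_self)
next
  case (step k)
  let ?\<nu> = "\<pi> m \<bind> kernel_prod M P m k"
  have S: "P (Suc k) \<in> measurable M (prob_algebra M)" by (intro P) simp
  have in_pa: "?\<nu> \<in> space (prob_algebra M)" "\<pi> k \<in> space (prob_algebra M)"
      "\<pi> (Suc k) \<in> space (prob_algebra M)"
    using step assms(1) by (auto intro!: bind_in_prob_algebra \<pi> kernel_prod_measurable)
  \<comment> \<open>Stationarity writes \<open>\<pi> (Suc k)\<close> as its own image under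
    \<open>P (Suc k)\<close>. Both arguments then pass through the same kernel, which does not
    increase their distance, and only the drift from \<open>\<pi> k\<close> to
    \<open>\<pi> (Suc k)\<close> is added.\<close>
  have "tv_dist (\<pi> m \<bind> kernel_prod M P m (Suc k)) (\<pi> (Suc k)) =
      tv_dist (?\<nu> \<bind> P (Suc k)) (\<pi> (Suc k) \<bind> P (Suc k))"
    using bind_kernel_prod_Suc[OF \<pi>[OF \<open>1 \<le> m\<close>] step(1)] stationary[of "Suc k"] by simp
  also have "\<dots> \<le> tv_dist ?\<nu> (\<pi> (Suc k))"
    by (rule tv_dist_bind_le_tv_dist[OF in_pa(1,3) S])
  also have "\<dots> \<le> tv_dist ?\<nu> (\<pi> k) + tv_dist (\<pi> k) (\<pi> (Suc k))"
    using in_pa by (intro tv_dist_triangle) (auto simp: space_prob_algebra)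
  also have "\<dots> \<le> (D m - D k) + (D k - D (Suc k))"
    using step assms(1) by (intro add_mono drift) auto
  finally show ?case by simp
qed

text \<open>The chain is compared with the one started in \<open>\<pi> m\<close>, which itself
  strays from \<open>\<pi> k\<close> only by the drift. The first bound serves complete blocks; the
  second serves a block cut short, for which no contraction estimate is available.\<close>

lemma tv_dist_block:
  assumes "1 \<le> m" "m \<le> k" and \<nu>: "\<nu> \<in> space (prob_algebra M)"
  shows "tv_dist (\<nu> \<bind> kernel_prod M P m k) (\<pi> k)
    \<le> dobrushin M (kernel_prod M P m k) * tv_dist \<nu> (\<pi> m) + (D m - D k)"
    and "tv_dist (\<nu> \<bind> kernel_prod M P m k) (\<pi> k) \<le> tv_dist \<nu> (\<pi> m) + (D m - D k)"
proof -
  let ?K = "kernel_prod M P m k"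
  have K: "?K \<in> measurable M (prob_algebra M)" by (rule kernel_prod_measurable)
  have in_pa: "\<pi> m \<in> space (prob_algebra M)" "\<pi> k \<in> space (prob_algebra M)"
    using assms by (auto intro: \<pi>)
  have "tv_dist (\<nu> \<bind> ?K) (\<pi> k)
      \<le> tv_dist (\<nu> \<bind> ?K) (\<pi> m \<bind> ?K) + tv_dist (\<pi> m \<bind> ?K) (\<pi> k)"
    using bind_in_prob_algebra[OF \<nu> K] bind_in_prob_algebra[OF in_pa(1) K] in_pa(2)
    by (intro tv_dist_triangle) (auto simp: space_prob_algebra)
  moreover note stationary_drift[OF assms(1,2)]
    tv_dist_bind_le_dobrushin[OF \<nu> in_pa(1) K] tv_dist_bind_le_tv_dist[OF \<nu> in_pa(1) K]
  ultimately show "tv_dist (\<nu> \<bind> ?K) (\<pi> k)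
      \<le> dobrushin M ?K * tv_dist \<nu> (\<pi> m) + (D m - D k)"
    and "tv_dist (\<nu> \<bind> ?K) (\<pi> k) \<le> tv_dist \<nu> (\<pi> m) + (D m - D k)"
    by linarith+
qed

lemma drift_antimono:
  assumes "1 \<le> i" "i \<le> k"
  shows "D k \<le> D i"
  using \<open>i \<le> k\<close>
proof (induction k rule: dec_induct)
  case (step k)
  then have "0 \<le> tv_dist (\<pi> k) (\<pi> (Suc k))"
    using assms \<pi>[of k] \<pi>[of "Suc k"] by (intro tv_dist_nonneg) (auto simp: space_prob_algebra)
  then show ?case using drift[of k] step assms by simp
qed simp

text \<open>The initial distance is at most 1, and a block multiplies the error by at most
  \<open>1 - x j\<close>, hence by at most \<open>exp (- x j)\<close>, so the product of the factors
  becomes an exponential of a sum. Drift enters additively and telescopes.\<close>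

lemma tv_dist_blocks:
  fixes n :: "nat \<Rightarrow> nat" and x :: "nat \<Rightarrow> real"
  assumes step: "\<And>j. 1 \<le> j \<Longrightarrow> \<mu> j = \<mu> (j - 1) \<bind> P j"
    and \<mu>: "\<mu> 0 \<in> space (prob_algebra M)"
    and n: "1 \<le> n i" "\<And>j. i \<le> j \<Longrightarrow> n j \<le> n (Suc j)"
    and x: "\<And>j. i \<le> j \<Longrightarrow> 0 \<le> x j"
    and contr: "\<And>j. i \<le> j \<Longrightarrow> dobrushin M (kernel_prod M P (n j) (n (Suc j))) \<le> 1 - x j"
    and "i \<le> k"
  shows "tv_dist (\<mu> (n k)) (\<pi> (n k)) \<le> exp (- (\<Sum>j=i..<k. x j)) + (D (n i) - D (n k))"
proof -
  have \<mu>_in: "\<mu> j \<in> space (prob_algebra M)" for j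
    by (rule chain_in_prob_algebra[OF step \<mu>])
  have mono: "n i \<le> n k" if "i \<le> k" for k
    using that by (induction k rule: dec_induct) (use n(2) in \<open>auto intro: order_trans\<close>)
  have sp: "space M \<noteq> {}"
    using prob_space.not_empty[of "\<mu> 0"] \<mu> sets_eq_imp_space_eq[of "\<mu> 0" M]
    by (auto simp: space_prob_algebra)
  show ?thesis
    using \<open>i \<le> k\<close>
  proof (induction k rule: dec_induct)
    case base
    show ?case
      using \<mu>_in[of "n i"] \<pi>[OF n(1)] by (auto intro: tv_dist_le_1 simp: space_prob_algebra)
  next
    case (step k)
    let ?K = "kernel_prod M P (n k) (n (Suc k))" and ?e = "tv_dist (\<mu> (n k)) (\<pi> (n k))"
    let ?E = "exp (- (\<Sum>j=i..<k. x j))"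
    have n1: "1 \<le> n k" using mono[OF step(1)] n(1) by simp
    have nS: "n k \<le> n (Suc k)" using n(2) step(1) by simp
    have DK: "D (n k) \<le> D (n i)" using drift_antimono[OF n(1) mono[OF step(1)]] .
    have K0: "0 \<le> dobrushin M ?K" by (rule dobrushin_nonneg[OF kernel_prod_measurable sp])
    have K1: "dobrushin M ?K \<le> 1 - x k" using contr step(1) by simp
    have K2: "dobrushin M ?K \<le> 1" using K1 x[OF step(1)] by simp
    have "\<mu> (n (Suc k)) = \<mu> (n k) \<bind> ?K"
      by (rule chain_eq_bind_kernel_prod[OF assms(1) \<mu>_in nS])
    then have "tv_dist (\<mu> (n (Suc k))) (\<pi> (n (Suc k)))
        \<le> dobrushin M ?K * ?e + (D (n k) - D (n (Suc k)))"
      using tv_dist_block(1)[OF n1 nS \<mu>_in[of "n k"]] by simp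
    also have "dobrushin M ?K * ?e \<le> dobrushin M ?K * ?E + dobrushin M ?K * (D (n i) - D (n k))"
      unfolding distrib_left[symmetric] by (rule mult_left_mono[OF step(3) K0])
    \<comment> \<open>The contraction of drift accumulated earlier is given away: its factor is
      merely bounded by 1, which keeps the drift term telescoping.\<close>
    also have "dobrushin M ?K * (D (n i) - D (n k)) \<le> D (n i) - D (n k)"
      using K2 K0 DK by (intro mult_left_le_one_le) auto
    also have "dobrushin M ?K * ?E \<le> exp (- x k) * ?E"
      using K1 exp_ge_add_one_self[of "- x k"] by (intro mult_right_mono) auto
    also have "exp (- x k) * ?E = exp (- (\<Sum>j=i..<Suc k. x j))"
      using step(1) by (simp flip: exp_add add: algebra_simps)
    finally show ?case by simp
  qed
qed

end

end

section \<open>Equilibrium distributions\<close>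

context simulated_annealing
begin

abbreviation "c j \<equiv> laplace \<upsilon> h (1 / T j)"

lemma exp_integrable:
  assumes "1 \<le> j"
  shows "integrable \<upsilon> (\<lambda>\<theta>. exp (- h \<theta> / T j))"
proof -
  interpret prob_space \<upsilon> by (rule prob_base)
  note [measurable] = h_measurable
  show ?thesis
    by (rule integrable_const_bound[where B = 1])
       (use h_nonneg T_pos[OF assms] in \<open>auto intro!: AE_I2 divide_nonneg_pos simp: space_base\<close>)
qed

lemma laplace_eq: "c j = (LINT \<theta>|\<upsilon>. exp (- h \<theta> / T j))"
  by (simp add: laplace_def)

lemma laplace_pos:
  assumes "1 \<le> j"
  shows "0 < c j"
proof -
  interpret prob_space \<upsilon> by (rule prob_base)
  have "0 < (LINT \<theta>|\<upsilon>. exp (- h \<theta> / T j))"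
    using integral_less_AE_space[of "\<lambda>_. 0" "\<lambda>\<theta>. exp (- h \<theta> / T j)"] exp_integrable[OF assms]
    by (simp add: emeasure_space_1)
  then show ?thesis by (simp add: laplace_eq)
qed

lemma emeasure_equilibrium:
  assumes "A \<in> sets \<upsilon>"
  shows "emeasure (equilibrium \<upsilon> h T j) A =
    (\<integral>\<^sup>+\<theta>. ennreal (exp (- h \<theta> / T j) / c j) * indicator A \<theta> \<partial>\<upsilon>)"
proof -
  note [measurable] = h_measurable
  show ?thesis
    unfolding equilibrium_def laplace_eq using assms by (subst emeasure_density) auto
qed

lemma equilibrium_in_prob_algebra:
  assumes "1 \<le> j"
  shows "equilibrium \<upsilon> h T j \<in> space (prob_algebra \<upsilon>)"
proof -
  have "emeasure (equilibrium \<upsilon> h T j) (space \<upsilon>) = 1"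
  proof -
    have "emeasure (equilibrium \<upsilon> h T j) (space \<upsilon>) =
        (\<integral>\<^sup>+\<theta>. ennreal (exp (- h \<theta> / T j) / c j) \<partial>\<upsilon>)"
      unfolding emeasure_equilibrium[OF sets.top] by (intro nn_integral_cong) simp
    also have "\<dots> = ennreal (LINT \<theta>|\<upsilon>. exp (- h \<theta> / T j) / c j)"
      using exp_integrable[OF assms] laplace_pos[OF assms]
      by (intro nn_integral_eq_integral) auto
    also have "\<dots> = 1"
      using laplace_pos[OF assms] by (simp add: laplace_eq)
    finally show ?thesis .
  qed
  then show ?thesis
    by (auto simp: space_prob_algebra equilibrium_def intro!: prob_spaceI)
qed

lemma tv_dist_equilibrium:
  assumes j: "1 \<le> j"
  shows "tv_dist (equilibrium \<upsilon> h T j) (equilibrium \<upsilon> h T (Suc j)) \<le> ln (c j) - ln (c (Suc j))"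
proof -
  let ?\<pi> = "equilibrium \<upsilon> h T"
  have Sj: "1 \<le> Suc j" by simp
  note cpos = laplace_pos[OF j] laplace_pos[OF Sj]
  have pr: "prob_space (?\<pi> j)" "prob_space (?\<pi> (Suc j))" and S: "sets (?\<pi> i) = sets \<upsilon>" for i
    using equilibrium_in_prob_algebra[OF j] equilibrium_in_prob_algebra[OF Sj]
    by (auto simp: space_prob_algebra equilibrium_def)
  \<comment> \<open>Cooling shrinks the unnormalised density pointwise because \<open>h\<close> is
    nonnegative. This yields both the monotonicity of \<open>c\<close> and the domination
    \<open>dom\<close>.\<close>
  have le: "exp (- h \<theta> / T (Suc j)) \<le> exp (- h \<theta> / T j)" if "\<theta> \<in> \<Theta>" for \<theta>
    using h_nonneg[OF that] T_decreasing[OF j, of "Suc j"] T_pos[OF Sj]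
    by (auto intro!: divide_left_mono mult_pos_pos T_pos j)
  have cle: "c (Suc j) \<le> c j"
    unfolding laplace_eq using exp_integrable[OF j] exp_integrable[OF Sj] le
    by (intro integral_mono) (auto simp: space_base)
  have dom: "c (Suc j) / c j * measure (?\<pi> (Suc j)) A \<le> measure (?\<pi> j) A"
    if A: "A \<in> sets \<upsilon>" for A
  proof -
    note [measurable] = h_measurable A
    have "ennreal (c (Suc j) / c j) * emeasure (?\<pi> (Suc j)) A =
        (\<integral>\<^sup>+\<theta>. ennreal (c (Suc j) / c j) *
          (ennreal (exp (- h \<theta> / T (Suc j)) / c (Suc j)) * indicator A \<theta>) \<partial>\<upsilon>)"
      unfolding emeasure_equilibrium[OF A] by (rule nn_integral_cmult[symmetric]) measurable
    also have "\<dots> \<le> emeasure (?\<pi> j) A"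
      unfolding emeasure_equilibrium[OF A] using cpos le
      by (intro nn_integral_mono)
         (auto simp: indicator_def space_base divide_right_mono simp flip: ennreal_mult)
    finally show ?thesis
      using pr cpos
      by (simp add: finite_measure.emeasure_eq_measure prob_space.finite_measure
          flip: ennreal_mult)
  qed
  show ?thesis
  proof (rule tv_dist_leI[OF pr])
    fix A assume "A \<in> sets (?\<pi> j)"
    then have A: "A \<in> sets \<upsilon>" by (simp add: S)
    let ?B = "space \<upsilon> - A"
    have B: "?B \<in> sets \<upsilon>" using A by auto
    have sp: "space (?\<pi> i) = space \<upsilon>" for i by (rule sets_eq_imp_space_eq[OF S])
    \<comment> \<open>\<open>dom\<close> bounds the excess of the later equilibrium over the earlier
      one, the opposite of the sign wanted here, so it is used on the complement of
      \<open>A\<close>.\<close>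
    have "measure (?\<pi> j) A - measure (?\<pi> (Suc j)) A
        = measure (?\<pi> (Suc j)) ?B - measure (?\<pi> j) ?B"
      using prob_space.prob_compl[OF pr(1), of A] prob_space.prob_compl[OF pr(2), of A] A
      by (simp add: S sp)
    also have "\<dots> \<le> (1 - c (Suc j) / c j) * measure (?\<pi> (Suc j)) ?B"
      using dom[OF B] by (simp add: algebra_simps)
    also have "\<dots> \<le> 1 - c (Suc j) / c j"
      using cle cpos prob_space.prob_le_1[OF pr(2)] by (intro mult_right_le_one_le) auto
    also have "\<dots> \<le> - ln (c (Suc j) / c j)"
      using ln_le_minus_one[of "c (Suc j) / c j"] cpos by simp
    also have "\<dots> = ln (c j) - ln (c (Suc j))"
      using cpos by (simp add: ln_div)
    finally show "measure (?\<pi> j) A - measure (?\<pi> (Suc j)) A \<le> ln (c j) - ln (c (Suc j))" .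
  qed (simp add: S)
qed

section \<open>Reversibility and stationarity\<close>

lemma detailed_balance:
  assumes j: "1 \<le> j" and \<theta>: "\<theta> \<in> \<Theta>" and \<psi>: "\<psi> \<in> \<Theta>"
  shows "exp (- h \<theta> / T j) * (acceptance h (T j) (q j) \<theta> \<psi> * q j \<theta> \<psi>) =
    exp (- h \<psi> / T j) * (acceptance h (T j) (q j) \<psi> \<theta> * q j \<psi> \<theta>)"
proof -
  \<comment> \<open>The accepted flow is the minimum of the two proposed flows, an expression
    symmetric in the two points. If the proposal density vanishes, the default acceptance 1 is
    multiplied by 0 and the minimum is 0 as well.\<close>
  have *: "exp (- h \<theta> / T j) * (acceptance h (T j) (q j) \<theta> \<psi> * q j \<theta> \<psi>) =
      min (exp (- h \<theta> / T j) * q j \<theta> \<psi>) (exp (- h \<psi> / T j) * q j \<psi> \<theta>)"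
    if \<theta>: "\<theta> \<in> \<Theta>" and \<psi>: "\<psi> \<in> \<Theta>" for \<theta> \<psi>
  proof (cases "q j \<theta> \<psi> = 0")
    case True
    then show ?thesis using q_nonneg[OF j \<psi> \<theta>] by (simp add: min_def)
  next
    case False
    then have q: "0 < q j \<theta> \<psi>" using q_nonneg[OF j \<theta> \<psi>] by simp
    have "(exp (- h \<psi>) / exp (- h \<theta>)) powr (1 / T j) = exp (- h \<psi> / T j) / exp (- h \<theta> / T j)"
      by (simp add: powr_def ln_div diff_divide_distrib exp_diff exp_add exp_minus field_simps)
    then show ?thesis
      using q by (simp add: acceptance_def min_mult_distrib_left min_mult_distrib_right field_simps)
  qed
  show ?thesis
    unfolding *[OF \<theta> \<psi>] *[OF \<psi> \<theta>] by (rule min.commute)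
qed

text \<open>Detailed balance equates the accepted flow out of \<open>A\<close> with the accepted
  flow into \<open>A\<close>. To avoid subtraction in \<open>ennreal\<close>, the outflow is added
  to both sides and cancelled only at the end.\<close>

lemma equilibrium_stationary:
  assumes j: "1 \<le> j"
  shows "equilibrium \<upsilon> h T j \<bind> annealing_kernel \<upsilon> h T q j = equilibrium \<upsilon> h T j"
proof (rule measure_eqI)
  let ?\<pi> = "equilibrium \<upsilon> h T j" and ?K = "annealing_kernel \<upsilon> h T q j"
  note \<pi> = equilibrium_in_prob_algebra[OF j] and K = annealing_kernel_measurable[OF j]
  show S: "sets (?\<pi> \<bind> ?K) = sets ?\<pi>"
    unfolding sets_bind'[OF \<pi> K] by (simp add: equilibrium_def)
  fix A assume "A \<in> sets (?\<pi> \<bind> ?K)"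
  then have A[measurable]: "A \<in> sets \<upsilon>" by (simp add: sets_bind'[OF \<pi> K])
  interpret prob_space \<upsilon> by (rule prob_base)
  interpret pair_sigma_finite \<upsilon> \<upsilon> ..
  note [measurable] = h_measurable
  let ?f = "\<lambda>\<theta> \<psi>. acceptance h (T j) (q j) \<theta> \<psi> * q j \<theta> \<psi>"
  let ?p = "\<lambda>\<theta>. exp (- h \<theta> / T j) / c j"
  let ?g = "\<lambda>\<theta> \<psi>. ennreal (?p \<theta>) * ennreal (?f \<theta> \<psi>)"
  have f[measurable]: "(\<lambda>(\<theta>, \<psi>). ?f \<theta> \<psi>) \<in> borel_measurable (\<upsilon> \<Otimes>\<^sub>M \<upsilon>)"
    by (rule move_density_measurable[OF j])
  have f1[measurable]: "?f \<theta> \<in> borel_measurable \<upsilon>" if "\<theta> \<in> \<Theta>" for \<theta>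
    using measurable_Pair2[OF f, of \<theta>] that by (simp add: space_base)
  have p0: "0 \<le> ?p \<theta>" for \<theta> using laplace_pos[OF j] by simp
  have KA[measurable]: "(\<lambda>\<theta>. emeasure (?K \<theta>) A) \<in> borel_measurable \<upsilon>"
    by (rule measurable_emeasure_kernel[OF measurable_prob_algebraD[OF K] A])
  have gsym: "?g \<theta> \<psi> = ?g \<psi> \<theta>" if "\<theta> \<in> \<Theta>" "\<psi> \<in> \<Theta>" for \<theta> \<psi>
    using detailed_balance[OF j that] p0 move_density_nonneg[OF j] that
    by (simp flip: ennreal_mult)
  have I: "(\<integral>\<^sup>+\<psi>. ?f \<theta> \<psi> \<partial>\<upsilon>) = ennreal (LINT \<psi>|\<upsilon>. ?f \<theta> \<psi>)" if \<theta>: "\<theta> \<in> \<Theta>" for \<theta>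
    using move_density_nonneg[OF j \<theta>]
    by (intro nn_integral_eq_integral move_density_integrable[OF j \<theta>]) (auto simp: space_base)
  \<comment> \<open>From a point of \<open>A\<close> the chain stays put with probability 1 minus
    the total acceptance; adding that acceptance to both sides removes the subtraction.\<close>
  have split: "emeasure (?K \<theta>) A + (\<integral>\<^sup>+\<psi>. ?f \<theta> \<psi> \<partial>\<upsilon>) * indicator A \<theta> =
      (\<integral>\<^sup>+\<psi>. ennreal (?f \<theta> \<psi>) * indicator A \<psi> \<partial>\<upsilon>) + indicator A \<theta>" if \<theta>: "\<theta> \<in> \<Theta>" for \<theta>
  proof -
    have I0: "0 \<le> (LINT \<psi>|\<upsilon>. ?f \<theta> \<psi>)"
      using move_density_nonneg[OF j \<theta>] by (intro integral_nonneg_AE) (auto simp: space_base)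
    have "ennreal (1 - (LINT \<psi>|\<upsilon>. ?f \<theta> \<psi>)) + ennreal (LINT \<psi>|\<upsilon>. ?f \<theta> \<psi>) = 1"
      using I0 move_density_le_1[OF j \<theta>] by (simp flip: ennreal_plus)
    then show ?thesis
      unfolding emeasure_annealing_kernel[OF j \<theta> A] annealing_prob_eq_emeasure[OF j \<theta> A] I[OF \<theta>]
      using f1[OF \<theta>] A
      by (cases "\<theta> \<in> A") (simp_all add: emeasure_density add.assoc)
  qed
  have "emeasure (?\<pi> \<bind> ?K) A = (\<integral>\<^sup>+\<theta>. emeasure (?K \<theta>) A \<partial>?\<pi>)"
    by (rule emeasure_bind_prob_algebra[OF \<pi> K A])
  also have "\<dots> = (\<integral>\<^sup>+\<theta>. ennreal (?p \<theta>) * emeasure (?K \<theta>) A \<partial>\<upsilon>)"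
    unfolding equilibrium_def laplace_eq by (rule nn_integral_density) measurable
  finally have L: "emeasure (?\<pi> \<bind> ?K) A = \<dots>" .
  have R: "emeasure ?\<pi> A = (\<integral>\<^sup>+\<theta>. ennreal (?p \<theta>) * indicator A \<theta> \<partial>\<upsilon>)"
    by (rule emeasure_equilibrium[OF A])
  \<comment> \<open>\<open>?X\<close> is the accepted flow starting in \<open>A\<close> and
    \<open>?Y\<close> the one ending in \<open>A\<close>; moves inside \<open>A\<close> count in
    both. Fubini and the symmetry \<open>gsym\<close> turn \<open>?Y\<close> into
    \<open>?X\<close>.\<close>
  let ?X = "\<integral>\<^sup>+\<theta>. ennreal (?p \<theta>) * ((\<integral>\<^sup>+\<psi>. ?f \<theta> \<psi> \<partial>\<upsilon>) * indicator A \<theta>) \<partial>\<upsilon>"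
  let ?Y = "\<integral>\<^sup>+\<theta>. ennreal (?p \<theta>) * (\<integral>\<^sup>+\<psi>. ennreal (?f \<theta> \<psi>) * indicator A \<psi> \<partial>\<upsilon>) \<partial>\<upsilon>"
  have "emeasure (?\<pi> \<bind> ?K) A + ?X =
      (\<integral>\<^sup>+\<theta>. ennreal (?p \<theta>) * (emeasure (?K \<theta>) A + (\<integral>\<^sup>+\<psi>. ?f \<theta> \<psi> \<partial>\<upsilon>) * indicator A \<theta>) \<partial>\<upsilon>)"
    unfolding L distrib_left by (rule nn_integral_add[symmetric]) measurable
  also have "\<dots> = (\<integral>\<^sup>+\<theta>. ennreal (?p \<theta>) *
      ((\<integral>\<^sup>+\<psi>. ennreal (?f \<theta> \<psi>) * indicator A \<psi> \<partial>\<upsilon>) + indicator A \<theta>) \<partial>\<upsilon>)"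
    by (intro nn_integral_cong) (simp add: split space_base)
  also have "\<dots> = ?Y + emeasure ?\<pi> A"
    unfolding R distrib_left by (rule nn_integral_add) measurable
  also have "?Y = (\<integral>\<^sup>+\<theta>. \<integral>\<^sup>+\<psi>. ?g \<theta> \<psi> * indicator A \<psi> \<partial>\<upsilon> \<partial>\<upsilon>)"
    by (intro nn_integral_cong, subst nn_integral_cmult[symmetric])
       (auto simp: space_base mult.assoc f1)
  also have "\<dots> = (\<integral>\<^sup>+\<psi>. \<integral>\<^sup>+\<theta>. ?g \<theta> \<psi> * indicator A \<psi> \<partial>\<upsilon> \<partial>\<upsilon>)"
    by (rule Fubini'[symmetric]) measurable
  also have "\<dots> = (\<integral>\<^sup>+\<psi>. \<integral>\<^sup>+\<theta>. ?g \<psi> \<theta> * indicator A \<psi> \<partial>\<upsilon> \<partial>\<upsilon>)"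
    by (intro nn_integral_cong arg_cong2[where f = "(*)"] gsym) (simp_all add: space_base)
  also have "\<dots> = ?X"
    by (intro nn_integral_cong, subst nn_integral_multc, simp add: space_base f1,
        subst nn_integral_cmult) (auto simp: space_base mult.assoc f1)
  finally have eq: "emeasure (?\<pi> \<bind> ?K) A + ?X = ?X + emeasure ?\<pi> A" .
  \<comment> \<open>The flow is at most the total mass 1, and finiteness is what permits its
    cancellation.\<close>
  have "?X \<le> (\<integral>\<^sup>+\<theta>. ennreal (?p \<theta>) * indicator (space \<upsilon>) \<theta> \<partial>\<upsilon>)"
  proof (intro nn_integral_mono mult_left_mono)
    fix \<theta> assume "\<theta> \<in> space \<upsilon>"
    then have \<theta>: "\<theta> \<in> \<Theta>" by (simp add: space_base)
    show "(\<integral>\<^sup>+\<psi>. ?f \<theta> \<psi> \<partial>\<upsilon>) * indicator A \<theta> \<le> indicator (space \<upsilon>) \<theta>"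
      using \<theta> I[OF \<theta>] move_density_le_1[OF j \<theta>] by (auto simp: space_base indicator_def)
  qed simp
  also have "\<dots> = emeasure ?\<pi> (space \<upsilon>)"
    by (rule emeasure_equilibrium[OF sets.top, symmetric])
  also have "\<dots> = 1"
    using prob_space.emeasure_space_1[of ?\<pi>] \<pi> sets_eq_imp_space_eq[of ?\<pi> \<upsilon>]
    by (simp add: space_prob_algebra)
  finally have "?X \<noteq> \<infinity>" by (auto simp: top_unique)
  with eq show "emeasure (?\<pi> \<bind> ?K) A = emeasure ?\<pi> A"
    by (simp add: add.commute)
qed

end

section \<open>Convergence\<close>

theorem theorem1:
  fixes \<Theta> :: "(real ^ 'r) set"
    and \<upsilon> :: "(real ^ 'r) measure"
    and h :: "real ^ 'r \<Rightarrow> real"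
    and T :: "nat \<Rightarrow> real"
    and q :: "nat \<Rightarrow> real ^ 'r \<Rightarrow> real ^ 'r \<Rightarrow> real"
    and n r :: "nat \<Rightarrow> nat"
    and d \<Delta>h :: real
    and P :: "nat \<Rightarrow> real ^ 'r \<Rightarrow> (real ^ 'r) measure"
    and \<mu> :: "nat \<Rightarrow> (real ^ 'r) measure"
  assumes annealing: "simulated_annealing \<Theta> \<upsilon> h T q"
    and P: "P = annealing_kernel \<upsilon> h T q"
    and \<Delta>h: "\<Delta>h = (SUP \<theta>\<in>\<Theta>. h \<theta>)"
    and d: "0 < d" "d < 1"
    and n: "strict_mono_on {1..} n"
    and j_minus_r: "filterlim (\<lambda>j. real j - real (r j)) at_top sequentially"
    and r: "filterlim r at_top sequentially"
    and contraction: "\<And>j. 1 \<le> j \<Longrightarrow>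
      dobrushin \<upsilon> (kernel_prod \<upsilon> P (n j) (n (j + 1)))
        \<le> 1 - (1 - d) * exp (- (\<Sum>l = n j + 1..n (j + 1). \<Delta>h / T l))"
    and divergence: "filterlim
      (\<lambda>k. \<Sum>j = r k..k. exp (- (\<Sum>l = n j + 1..n (j + 1). \<Delta>h / T l))) at_top sequentially"
    and laplace_ratio:
      "(\<lambda>k. laplace \<upsilon> h (1 / T (n (r k))) / laplace \<upsilon> h (1 / T (n (k + 2)))) \<longlonglongrightarrow> 1"
    and initial: "prob_space (\<mu> 0)" "sets (\<mu> 0) = sets \<upsilon>"
    and step: "\<And>j. 1 \<le> j \<Longrightarrow> \<mu> j = \<mu> (j - 1) \<bind> P j"
  shows "(\<lambda>j. tv_dist (\<mu> j) (equilibrium \<upsilon> h T j)) \<longlonglongrightarrow> 0"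
proof -
  interpret simulated_annealing \<Theta> \<upsilon> h T q by (rule annealing)
  let ?\<pi> = "equilibrium \<upsilon> h T"
  let ?D = "\<lambda>j. ln (c j)"
  define w where "w j = exp (- (\<Sum>l = n j + 1..n (j + 1). \<Delta>h / T l))" for j
  \<comment> \<open>The first term is the initial error left after the blocks \<open>r k\<close> to
    \<open>k\<close>; the second is the whole drift from time \<open>n (r k)\<close> to time
    \<open>n (k + 2)\<close>.\<close>
  define B where "B k = exp (- ((1 - d) * (\<Sum>j=r k..k. w j))) + ln (c (n (r k)) / c (n (k + 2)))" for k
  have K: "P j \<in> measurable \<upsilon> (prob_algebra \<upsilon>)" if "1 \<le> j" for j
    unfolding P by (rule annealing_kernel_measurable[OF that])
  have \<mu>0: "\<mu> 0 \<in> space (prob_algebra \<upsilon>)"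
    using initial by (simp add: space_prob_algebra)
  have \<mu>_in: "\<mu> j \<in> space (prob_algebra \<upsilon>)" for j
    by (rule chain_in_prob_algebra[where P = P, OF K step \<mu>0])
  have stat: "?\<pi> j \<bind> P j = ?\<pi> j" if "1 \<le> j" for j
    unfolding P by (rule equilibrium_stationary[OF that])
  note blocks = tv_dist_blocks[where D = ?D, OF K equilibrium_in_prob_algebra stat tv_dist_equilibrium]
    and block = tv_dist_block(2)[where D = ?D, OF K equilibrium_in_prob_algebra stat tv_dist_equilibrium]
    and antimono = drift_antimono[where D = ?D, OF K equilibrium_in_prob_algebra stat tv_dist_equilibrium]
  have n_less: "n i < n k" if "1 \<le> i" "i < k" for i k
    using strict_mono_onD[OF n, of i k] that by simp
  \<comment> \<open>The value \<open>n 1\<close> may be 0, hence the shift by one. With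
    \<open>2 \<le> r k\<close> the starting time \<open>n (r k)\<close> is at least 1, where
    temperatures and equilibria are meaningful.\<close>
  have n_ge: "j \<le> Suc (n j)" if "1 \<le> j" for j
    using that
  proof (induction j rule: dec_induct)
    case (step j)
    then show ?case using n_less[of j "Suc j"] by simp
  qed simp
  have bound: "tv_dist (\<mu> m) (?\<pi> m) \<le> B k"
    if rk: "2 \<le> r k" "r k \<le> k" and m: "n (k + 1) \<le> m" "m < n (k + 2)" for k m
  proof -
    have n1: "1 \<le> n (r k)" using n_ge[of "r k"] rk by simp
    have nk: "1 \<le> n (k + 1)" using n_ge[of "k + 1"] rk by simp
    have "tv_dist (\<mu> (n (Suc k))) (?\<pi> (n (Suc k)))
        \<le> exp (- (\<Sum>j=r k..<Suc k. (1 - d) * w j)) + (?D (n (r k)) - ?D (n (Suc k)))"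
    proof (rule blocks[OF _ _ _ _ step \<mu>0])
      show "n j \<le> n (Suc j)" if "r k \<le> j" for j
        using n_less[of j "Suc j"] that rk by simp
      show "dobrushin \<upsilon> (kernel_prod \<upsilon> P (n j) (n (Suc j))) \<le> 1 - (1 - d) * w j"
        if "r k \<le> j" for j
        using contraction[of j] that rk by (simp add: w_def)
    qed (use n1 rk d in \<open>auto simp: w_def\<close>)
    \<comment> \<open>The incomplete block from \<open>n (k + 1)\<close> to \<open>m\<close>
      contributes drift but no contraction. Extending the drift to \<open>n (k + 2)\<close> then
      makes the bound independent of \<open>m\<close>.\<close>
    moreover have "\<mu> m = \<mu> (n (k + 1)) \<bind> kernel_prod \<upsilon> P (n (k + 1)) m"
      using K step \<mu>_in m(1) by (rule chain_eq_bind_kernel_prod)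
    then have "tv_dist (\<mu> m) (?\<pi> m)
        \<le> tv_dist (\<mu> (n (k + 1))) (?\<pi> (n (k + 1))) + (?D (n (k + 1)) - ?D m)"
      using block[OF _ _ _ _ nk m(1) \<mu>_in[of "n (k + 1)"]] by simp
    moreover have "?D (n (k + 2)) \<le> ?D m"
      using nk m by (intro antimono) auto
    moreover have "ln (c (n (r k)) / c (n (k + 2))) = ?D (n (r k)) - ?D (n (k + 2))"
      using laplace_pos[of "n (r k)"] laplace_pos[of "n (k + 2)"] n1 nk m by (simp add: ln_div)
    ultimately show ?thesis
      by (simp add: B_def sum_distrib_left atLeastLessThanSuc_atLeastAtMost)
  qed
  have B: "B \<longlonglongrightarrow> 0"
  proof -
    have "filterlim (\<lambda>k. (1 - d) * (\<Sum>j=r k..k. w j)) at_top sequentially"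
      using divergence d by (intro filterlim_tendsto_pos_mult_at_top[OF tendsto_const]) (auto simp: w_def)
    then have "(\<lambda>k. exp (- ((1 - d) * (\<Sum>j=r k..k. w j)))) \<longlonglongrightarrow> 0"
      by (intro filterlim_compose[OF exp_at_bot] filterlim_uminus_at_bot[THEN iffD2]) simp
    moreover have "(\<lambda>k. ln (c (n (r k)) / c (n (k + 2)))) \<longlonglongrightarrow> ln 1"
      by (rule tendsto_ln[OF laplace_ratio]) simp
    ultimately show ?thesis
      unfolding B_def by (auto dest: tendsto_add)
  qed
  show ?thesis
  proof (rule LIMSEQ_I)
    fix e :: real assume e: "0 < e"
    have "eventually (\<lambda>k. 2 \<le> r k) sequentially"
      using r by (simp add: filterlim_at_top)
    \<comment> \<open>The divergence of j - r_j makes this difference eventually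
      nonnegative.\<close>
    moreover have "eventually (\<lambda>k. r k \<le> k) sequentially"
      using filterlim_at_top[THEN iffD1, OF j_minus_r, rule_format, of 0] by simp
    moreover have "eventually (\<lambda>k. B k < e) sequentially"
      using order_tendstoD(2)[OF B e] .
    ultimately have "eventually (\<lambda>k. 2 \<le> r k \<and> r k \<le> k \<and> B k < e) sequentially"
      by eventually_elim simp
    then obtain k0 where k0: "\<And>k. k0 \<le> k \<Longrightarrow> 2 \<le> r k \<and> r k \<le> k \<and> B k < e"
      by (auto simp: eventually_sequentially)
    have "norm (tv_dist (\<mu> m) (?\<pi> m) - 0) < e" if m: "max 1 (n (k0 + 1)) \<le> m" for m
    proof -
      \<comment> \<open>This picks the window from \<open>n (k + 1)\<close> up to, but excluding,
        \<open>n (k + 2)\<close> that contains \<open>m\<close>. The candidate \<open>m + 2\<close>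
        shows that the minimum exists, since \<open>n_ge\<close> gives
        \<open>m < n (m + 4)\<close>.\<close>
      define k where "k = (LEAST k. m < n (k + 2))"
      have "m < n (m + 2 + 2)" using n_ge[of "m + 2 + 2"] by simp
      then have k2: "m < n (k + 2)" unfolding k_def by (rule LeastI)
      have "k0 \<le> k"
      proof (rule ccontr)
        assume "\<not> k0 \<le> k"
        then have "n (k + 2) \<le> n (k0 + 1)"
          using n_less[of "k + 2" "k0 + 1"] by (cases "k + 2 = k0 + 1") auto
        with m k2 show False by simp
      qed
      \<comment> \<open>For \<open>k = k0\<close> this is the choice of the threshold for
        \<open>m\<close>; for larger \<open>k\<close> it is the minimality of \<open>k\<close>,
        tested at \<open>k - 1\<close>.\<close>
      have k1: "n (k + 1) \<le> m"
      proof (cases "k = k0")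
        case False
        then have "k - 1 < k" "k - 1 + 2 = k + 1" using \<open>k0 \<le> k\<close> by auto
        then show ?thesis
          using not_less_Least[of "k - 1" "\<lambda>k. m < n (k + 2)", folded k_def] by simp
      qed (use m in simp)
      have "tv_dist (\<mu> m) (?\<pi> m) < e"
        using bound[OF _ _ k1 k2] k0[OF \<open>k0 \<le> k\<close>] by simp
      moreover have "0 \<le> tv_dist (\<mu> m) (?\<pi> m)"
        using \<mu>_in[of m] equilibrium_in_prob_algebra[of m] m
        by (intro tv_dist_nonneg) (auto simp: space_prob_algebra)
      ultimately show ?thesis by simp
    qed
    then show "\<exists>no. \<forall>m\<ge>no. norm (tv_dist (\<mu> m) (?\<pi> m) - 0) < e" by blast
  qed
qed

end
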